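(* For every complex number $s$ with $\operatorname{Re}(s)>1$, $$\frac{1}{\zeta(s)}=1+\lim_{n\to\infty}\frac{1}{(n!)^s}\sum_{A\subseteq L_{n!}\setminus\{1,n!\}}(-1)^{|A|}\,(\gcd(A))^s .$$ In particular, for $s=2$, $$\lim_{n\to\infty}\frac{1}{(n!)^2}\sum_{A\subseteq L_{n!}\setminus\{1,n!\}}(-1)^{|A|-1}\,(\gcd(A))^2=1-\frac{6}{\pi^2}.$$ Both identities also hold if $n!$ is replaced throughout by the primorial $n\#$.
   Context: $\zeta$ is the Riemann zeta function. For a positive integer $m$, $L_m$ denotes the set of positive divisors of $m$. $\gcd(A)$ denotes the greatest common divisor of the elements of $A$, with the convention $\gcd(\emptyset)=0$; since $\operatorname{Re}(s)>1$, the term of $A=\emptyset$ is $0^s=0$. The primorial $n\#$ is the product of all primes less than or equal to $n$. *)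

theory Defs
  imports "HOL-Analysis.Analysis" "HOL-Computational_Algebra.Primes"
begin

text \<open>
  The Riemann zeta function, given by its Dirichlet series. This is meaningful only on the
  half-plane of convergence \<^term>\<open>Re s > 1\<close>; the analytic continuation is not covered.
\<close>
definition riemann_zeta :: "complex \<Rightarrow> complex" where
  "riemann_zeta s = (\<Sum>k. 1 / of_nat (Suc k) powr s)"

definition pos_divisors :: "nat \<Rightarrow> nat set" where
  "pos_divisors m = {d. 0 < d \<and> d dvd m}"

definition primorial :: "nat \<Rightarrow> nat" where
  "primorial n = \<Prod>{p. prime p \<and> p \<le> n}"

text \<open>
  In the two expressions below the summand of \<^term>\<open>{} :: nat set\<close> vanishes, since
  \<^prop>\<open>Gcd ({} :: nat set) = 0\<close> and \<^prop>\<open>(0 :: complex) powr s = 0\<close>.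
\<close>
definition gcd_sum :: "complex \<Rightarrow> nat \<Rightarrow> complex" where
  "gcd_sum s m = 1 / (of_nat m powr s) *
     (\<Sum>A \<in> Pow (pos_divisors m - {1, m}). (-1) ^ card A * of_nat (Gcd A) powr s)"

text \<open>
  The exponent \<open>|A| - 1\<close> is an integer exponent; it equals \<open>-1\<close> for the empty set.
\<close>
definition gcd_sum_sq :: "nat \<Rightarrow> real" where
  "gcd_sum_sq m = 1 / (real m)\<^sup>2 *
     (\<Sum>A \<in> Pow (pos_divisors m - {1, m}). (-1) powi (int (card A) - 1) * (real (Gcd A))\<^sup>2)"

end

theory Submission
  imports Defs
begin

text \<open>
  Let \<open>D\<close> be the set of divisors of \<open>m\<close> other than \<open>1\<close> and \<open>m\<close>. If \<open>x \<in> D\<close> divides \<open>y \<in> D\<close> and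
  \<open>x \<noteq> y\<close>, then adding \<open>y\<close> to or removing it from a set that contains \<open>x\<close> does not change the gcd
  but flips the sign \<open>(-1) ^ |A|\<close>, so the sets containing \<open>x\<close> contribute nothing in total. Discarding
  such \<open>x\<close> one at a time (\<open>sum_Pow_toggle\<close>) leaves only the maximal proper divisors \<open>m / p\<close> with
  \<open>p\<close> a prime factor of \<open>m\<close>. The gcd of \<open>m / p\<close> over \<open>p \<in> P\<close> is \<open>m / \<Prod>P\<close> (\<open>Gcd_coatoms\<close>), also
  for \<open>P = {}\<close> if \<open>m\<close> itself is included in the gcd. The sum thereby becomes
  \[ m^s \sum_P (-1)^{|P|} \prod_{p \in P} p^{-s} = m^s \prod_{p \mid m} (1 - p^{-s}), \]
  and the only price for including \<open>m\<close> is that the empty set now contributes \<open>m^s\<close> and not \<open>0\<close>. Thus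
  \<open>gcd_sum s m = \<Prod>(1 - p^(-s)) - 1\<close> unless \<open>m\<close> is prime (\<open>gcd_sum_eq_euler_product\<close>).

  Both \<open>n!\<close> and the primorial of \<open>n\<close> have exactly the primes up to \<open>n\<close> as prime factors, so what
  remains is the Euler product for \<open>1 / \<zeta>(s)\<close>. It is obtained by sieving: multiplying the
  Dirichlet series by \<open>1 - p^(-s)\<close> deletes the multiples of \<open>p\<close>, and once all primes up to \<open>n\<close> are
  sieved out the terms left are the one of \<open>1\<close> and some of those beyond \<open>n\<close>, which vanish in the
  limit. Hence \<open>\<zeta>(s) \<Prod>(1 - p^(-s))\<close> tends to \<open>1\<close>, which also shows that \<open>\<zeta>(s)\<close> is nonzero.
\<close>

section \<open>Cancellation in alternating sums over subsets\<close>

text \<open>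
  The sets \<open>B\<close> and \<open>insert y B\<close>, with \<open>y \<notin> B\<close> and \<open>x \<in> B\<close>, cancel.
\<close>
lemma sum_Pow_remove:
  fixes f :: "'a set \<Rightarrow> 'b :: comm_ring_1"
  assumes "finite D" "x \<notin> D" "y \<in> D"
    and toggle: "\<And>B. B \<subseteq> D \<Longrightarrow> f (insert y (insert x B)) = f (insert x B)"
  shows "(\<Sum>A\<in>Pow (insert x D). (-1) ^ card A * f A) = (\<Sum>A\<in>Pow D. (-1) ^ card A * f A)"
proof -
  have split: "(\<Sum>A\<in>Pow (insert z E). g A) = (\<Sum>A\<in>Pow E. g A) + (\<Sum>A\<in>Pow E. g (insert z A))"
    if "finite E" "z \<notin> E" for z :: 'a and E and g :: "'a set \<Rightarrow> 'b"
  proof -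
    have "inj_on (insert z) (Pow E)"
      using that by (intro inj_onI) (metis PowD insert_ident subsetD)
    moreover have "Pow E \<inter> insert z ` Pow E = {}" using that by auto
    ultimately show ?thesis
      using that by (simp add: Pow_insert sum.union_disjoint sum.reindex)
  qed
  define E where "E = D - {y}"
  have E: "finite E" "y \<notin> E" "D = insert y E" "x \<notin> E" "x \<noteq> y"
    using assms by (auto simp: E_def)
  have "(-1) ^ card (insert x (insert y A)) * f (insert x (insert y A))
      = - ((-1) ^ card (insert x A) * f (insert x A))" if "A \<in> Pow E" for A
  proof -
    have "finite A" "x \<notin> A" "y \<notin> A" using that E finite_subset by auto
    moreover have "f (insert x (insert y A)) = f (insert x A)"
      using toggle[of A] that E by (auto simp: insert_commute)
    ultimately show ?thesis using \<open>x \<noteq> y\<close> by simp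
  qed
  hence "(\<Sum>A\<in>Pow D. (-1) ^ card (insert x A) * f (insert x A)) = 0"
    unfolding E(3) split[OF E(1,2)] by (simp add: sum_negf)
  thus ?thesis
    using split[OF assms(1,2), of "\<lambda>A. (-1) ^ card A * f A"] by simp
qed

lemma sum_Pow_toggle:
  fixes f :: "'a set \<Rightarrow> 'b :: comm_ring_1"
  assumes "finite D" "C \<subseteq> D"
    and toggle: "\<And>x. x \<in> D - C \<Longrightarrow> \<exists>y\<in>C. \<forall>B\<subseteq>D. x \<in> B \<longrightarrow> f (insert y B) = f B"
  shows "(\<Sum>A\<in>Pow D. (-1) ^ card A * f A) = (\<Sum>A\<in>Pow C. (-1) ^ card A * f A)"
proof -
  have "(\<Sum>A\<in>Pow (C \<union> X). (-1) ^ card A * f A) = (\<Sum>A\<in>Pow C. (-1) ^ card A * f A)"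
    if "finite X" "X \<subseteq> D - C" for X
    using that
  proof (induction X rule: finite_induct)
    case (insert x X)
    from toggle[of x] insert.prems obtain y
      where y: "y \<in> C" "\<forall>B\<subseteq>D. x \<in> B \<longrightarrow> f (insert y B) = f B" by auto
    have "finite (C \<union> X)" using assms insert.hyps finite_subset by auto
    moreover have "f (insert y (insert x B)) = f (insert x B)" if "B \<subseteq> C \<union> X" for B
      using y that insert.prems \<open>C \<subseteq> D\<close> by (subst y(2)[rule_format]) auto
    ultimately show ?case
      using sum_Pow_remove[of "C \<union> X" x y f] y insert by auto
  qed simp
  from this[of "D - C"] show ?thesis
    using assms by (simp add: Un_absorb1)
qed

section \<open>The sum over sets of divisors\<close>

lemma Gcd_coatoms:
  assumes "m > 0" "finite P" "P \<subseteq> prime_factors (m::nat)"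
  shows "\<Prod>P dvd m \<and> Gcd (insert m ((\<lambda>p. m div p) ` P)) = m div \<Prod>P"
  using assms(2,3)
proof (induction P rule: finite_induct)
  case (insert p P)
  hence IH: "\<Prod>P dvd m" "Gcd (insert m ((\<lambda>p. m div p) ` P)) = m div \<Prod>P" by auto
  have p: "prime p" "p dvd m" using insert.prems by (auto simp: prime_factors_dvd)
  have "coprime p q" if "q \<in> P" for q
    using that insert p by (intro primes_coprime) (auto simp: prime_factors_dvd)
  hence cop: "coprime p (\<Prod>P)" by (rule prod_coprime_right)
  hence "p * \<Prod>P dvd m" using p IH(1) by (intro divides_mult) auto
  then obtain k where k: "m = p * \<Prod>P * k" by (rule dvdE)
  have pos: "p > 0" "\<Prod>P > 0" using k \<open>m > 0\<close> by auto
  have "Gcd (insert m ((\<lambda>p. m div p) ` insert p P))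
      = gcd (m div p) (Gcd (insert m ((\<lambda>p. m div p) ` P)))"
    by (simp add: insert_commute gcd.left_commute)
  also have "\<dots> = gcd (m div p) (m div \<Prod>P)" by (simp only: IH(2))
  also have "m div p = \<Prod>P * k" using k pos by simp
  also have "m div \<Prod>P = p * k" using k pos by simp
  also have "gcd (\<Prod>P * k) (p * k) = k"
    using coprime_imp_gcd_eq_1[OF cop] by (simp add: gcd_mult_right gcd.commute)
  also have "k = m div \<Prod>(insert p P)" using k pos insert.hyps by simp
  finally show ?case using k insert.hyps by simp
qed auto

lemma powr_of_nat_mult:
  "complex_of_nat (m * n) powr s = of_nat m powr s * of_nat n powr s"
  by (simp add: powr_times_real)

lemma powr_of_nat_prod:
  "complex_of_nat (\<Prod>P) powr s = (\<Prod>p\<in>P. of_nat p powr s)"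
  by (induction P rule: infinite_finite_induct) (simp_all add: powr_of_nat_mult del: of_nat_mult of_nat_prod)

text \<open>
  A prime \<open>m\<close> is excluded because its only maximal proper divisor \<open>1\<close> is not available in the sum,
  so that the left-hand side is \<open>0\<close>.
\<close>
lemma gcd_sum_eq_euler_product:
  assumes "m > 0" "\<not> prime m"
  shows "gcd_sum s m = (\<Prod>p\<in>prime_factors m. 1 - of_nat p powr (-s)) - 1"
proof -
  define D where "D = pos_divisors m - {1, m}"
  define f where "f A = complex_of_nat (Gcd (insert m A)) powr s" for A
  define c where "c p = m div p" for p
  define C where "C = c ` prime_factors m"
  have fin: "finite D" using assms by (simp add: D_def pos_divisors_def)
  have CD: "C \<subseteq> D"
  proof -
    have "c p \<in> D" if "prime p" "p dvd m" for p
    proof -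
      obtain k where k: "m = p * k" using \<open>p dvd m\<close> by (rule dvdE)
      have "c p = k" using k \<open>m > 0\<close> by (simp add: c_def)
      thus ?thesis using k assms that
        by (auto simp: D_def pos_divisors_def dest: prime_gt_1_nat)
    qed
    thus ?thesis by (auto simp: C_def prime_factors_dvd)
  qed
  have inj: "inj_on c (prime_factors m)"
  proof (rule inj_onI)
    fix p q assume pq: "p \<in> prime_factors m" "q \<in> prime_factors m" and eq: "c p = c q"
    from pq have "p * c p = m" "q * c q = m" by (auto simp: c_def prime_factors_dvd)
    hence *: "p * c p = m" "q * c p = m" by (simp_all add: eq)
    hence "c p \<noteq> 0" using \<open>m > 0\<close> by (cases "c p = 0") auto
    thus "p = q" using * by (metis mult_right_cancel)
  qed
  have toggle: "\<exists>y\<in>C. \<forall>B\<subseteq>D. x \<in> B \<longrightarrow> f (insert y B) = f B" if "x \<in> D - C" for x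
  proof -
    from that have x: "x dvd m" "x \<noteq> m" by (auto simp: D_def pos_divisors_def)
    then obtain k where k: "m = x * k" by (elim dvdE)
    with x have "k \<noteq> 1" by auto
    then obtain p where p: "prime p" "p dvd k" using prime_factor_nat by blast
    then obtain l where l: "k = p * l" by (elim dvdE)
    have "c p = x * l" using k l p by (simp add: c_def mult.left_commute prime_gt_0_nat)
    hence dvd: "x dvd c p" by simp
    have "c p \<in> C" using p k l assms by (auto simp: C_def prime_factors_dvd)
    moreover have "f (insert (c p) B) = f B" if "x \<in> B" for B
    proof -
      have "Gcd (insert m B) dvd c p"
        using that dvd by (meson Gcd_dvd dvd_trans insertI2)
      hence "gcd (c p) (Gcd (insert m B)) = Gcd (insert m B)"
        by (simp add: gcd_nat.absorb2)
      thus ?thesis unfolding f_def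
        by (metis Gcd_insert insert_commute)
    qed
    ultimately show ?thesis by blast
  qed
  have m0: "complex_of_nat m powr s \<noteq> 0" using assms by simp
  have summand: "(-1) ^ card (c ` P) * f (c ` P)
      = of_nat m powr s * ((\<Prod>p\<in>P. - (of_nat p powr (-s))) * (\<Prod>p\<in>prime_factors m - P. 1))"
    if "P \<in> Pow (prime_factors m)" for P
  proof -
    have P: "finite P" "P \<subseteq> prime_factors m" using that finite_subset by auto
    note G = Gcd_coatoms[OF \<open>m > 0\<close> P]
    from G obtain k where k: "m = \<Prod>P * k" by (elim conjE dvdE)
    have "\<Prod>P > 0" using k \<open>m > 0\<close> by (cases "\<Prod>P = 0") auto
    hence "f (c ` P) = of_nat k powr s" using G k unfolding f_def c_def by simp
    also have "\<dots> = of_nat m powr s * of_nat (\<Prod>P) powr (-s)"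
      unfolding k powr_of_nat_mult using \<open>\<Prod>P > 0\<close> by (simp add: powr_minus del: of_nat_prod)
    finally have "f (c ` P) = of_nat m powr s * (\<Prod>p\<in>P. of_nat p powr (-s))"
      by (simp only: powr_of_nat_prod)
    moreover have "card (c ` P) = card P"
      using inj P by (meson card_image inj_on_subset)
    ultimately show ?thesis by (simp add: prod_uminus)
  qed
  have "(\<Sum>A\<in>Pow D. (-1) ^ card A * f A) = (\<Sum>A\<in>Pow C. (-1) ^ card A * f A)"
    by (rule sum_Pow_toggle[OF fin CD toggle])
  also have "\<dots> = (\<Sum>P\<in>Pow (prime_factors m). (-1) ^ card (c ` P) * f (c ` P))"
    unfolding C_def by (subst image_Pow_surj[OF refl, symmetric])
      (simp add: sum.reindex[OF inj_on_image_Pow[OF inj]])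
  also have "\<dots> = of_nat m powr s * (\<Prod>p\<in>prime_factors m. - (of_nat p powr (-s)) + 1)"
    unfolding prod_add[OF finite_set_mset] sum_distrib_left by (rule sum.cong[OF refl summand])
  finally have full: "(\<Sum>A\<in>Pow D. (-1) ^ card A * f A) = \<dots>" .
  \<comment> \<open>A nonempty \<open>A\<close> has the same gcd with and without \<open>m\<close>, as its elements divide \<open>m\<close>.\<close>
  have "(\<Sum>A\<in>Pow D - {{}}. (-1) ^ card A * complex_of_nat (Gcd A) powr s)
      = (\<Sum>A\<in>Pow D - {{}}. (-1) ^ card A * f A)"
  proof (rule sum.cong[OF refl])
    fix A assume A: "A \<in> Pow D - {{}}"
    then obtain a where "a \<in> A" "a dvd m" by (auto simp: D_def pos_divisors_def)
    hence "Gcd A dvd m" by (meson Gcd_dvd dvd_trans)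
    thus "(-1) ^ card A * complex_of_nat (Gcd A) powr s = (-1) ^ card A * f A"
      by (simp add: f_def gcd_nat.absorb2)
  qed
  hence "(\<Sum>A\<in>Pow D. (-1) ^ card A * complex_of_nat (Gcd A) powr s)
      = (\<Sum>A\<in>Pow D. (-1) ^ card A * f A) - of_nat m powr s"
    using fin by (simp add: sum.remove[of "Pow D" "{}"] f_def)
  thus ?thesis
    unfolding gcd_sum_def D_def[symmetric] full using m0 by (simp add: field_simps)
qed

section \<open>The Euler product\<close>

text \<open>
  Adding a prime \<open>p\<close> to \<open>P\<close> deletes the terms at \<open>p * k\<close> with \<open>k\<close> itself in the index set, since
  divisibility of \<open>p * k\<close> by a prime \<open>q \<noteq> p\<close> is the same as that of \<open>k\<close>. By multiplicativity the
  deleted terms add up to \<open>a p\<close> times the whole sum.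
\<close>
lemma infsum_sieve:
  fixes a :: "nat \<Rightarrow> complex"
  assumes mult: "\<And>i j. a (i * j) = a i * a j"
    and summable: "a summable_on UNIV"
    and "finite P" "\<And>p. p \<in> P \<Longrightarrow> prime p"
  shows "infsum a {k. k > 0 \<and> (\<forall>p\<in>P. \<not> p dvd k)} = (\<Prod>p\<in>P. 1 - a p) * infsum a {0<..}"
  using assms(3,4)
proof (induction P rule: finite_induct)
  case empty
  show ?case by (simp add: greaterThan_def)
next
  case (insert p P)
  define S where "S = {k. k > 0 \<and> (\<forall>p\<in>P. \<not> p dvd k)}"
  define T where "T = {k. k > 0 \<and> (\<forall>p\<in>insert p P. \<not> p dvd k)}"
  have p: "prime p" using insert by simp
  hence "p > 0" by (rule prime_gt_0_nat)
  have "q dvd p * k \<longleftrightarrow> q dvd k" if "q \<in> P" for q k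
    using that insert p by (metis insertCI prime_dvd_mult_iff primes_dvd_imp_eq)
  note dvd_iff = this
  have S: "S = T \<union> (*) p ` S"
  proof (intro equalityI subsetI)
    fix k assume k: "k \<in> S"
    show "k \<in> T \<union> (*) p ` S"
    proof (cases "p dvd k")
      case True
      then obtain l where "k = p * l" by (rule dvdE)
      with k show ?thesis by (auto simp: S_def dvd_iff)
    qed (use k in \<open>auto simp: S_def T_def\<close>)
  qed (use \<open>p > 0\<close> in \<open>auto simp: S_def T_def dvd_iff\<close>)
  have disj: "T \<inter> (*) p ` S = {}" by (auto simp: T_def)
  have summ: "a summable_on X" for X using summable summable_on_subset_banach by blast
  have inj: "inj_on ((*) p) S" using \<open>p > 0\<close> by (auto simp: inj_on_def)
  have "infsum a S = infsum a T + infsum a ((*) p ` S)"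
    by (subst S, rule infsum_Un_disjoint[OF summ summ disj])
  also have "infsum a ((*) p ` S) = a p * infsum a S"
    by (simp add: infsum_reindex[OF inj] o_def mult infsum_cmult_right')
  finally have "infsum a S - a p * infsum a S = infsum a T"
    unfolding diff_eq_eq .
  hence "infsum a T = (1 - a p) * infsum a S" by (simp add: left_diff_distrib)
  moreover have "infsum a S = (\<Prod>p\<in>P. 1 - a p) * infsum a {0<..}"
    using insert by (simp add: S_def)
  ultimately show ?case using insert.hyps by (simp add: T_def)
qed

lemma euler_product:
  fixes a :: "nat \<Rightarrow> complex"
  assumes mult: "\<And>i j. a (i * j) = a i * a j" and "a 1 = 1"
    and summable: "summable (\<lambda>k. norm (a k))"
  shows "(\<lambda>n. (\<Prod>p | prime p \<and> p \<le> n. 1 - a p) * infsum a {0<..}) \<longlonglongrightarrow> 1"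
proof -
  have norm_summ: "(\<lambda>k. norm (a k)) summable_on X" for X
    by (rule summable_on_subset_banach[OF norm_summable_imp_summable_on]) (use summable in auto)
  have summ: "a summable_on X" for X
    by (rule abs_summable_summable) (rule norm_summ)
  have fin: "finite {p::nat. prime p \<and> p \<le> n}" for n by simp
  define S where "S n = {k. k > 0 \<and> (\<forall>p\<in>{p::nat. prime p \<and> p \<le> n}. \<not> p dvd k)}" for n
  have S: "infsum a (S n) = (\<Prod>p | prime p \<and> p \<le> n. 1 - a p) * infsum a {0<..}" for n
    unfolding S_def by (rule infsum_sieve[OF mult summ fin]) auto
  have bound: "norm (infsum a (S n) - 1)
      \<le> infsum (\<lambda>k. norm (a k)) UNIV - (\<Sum>k\<le>n. norm (a k))" for n
  proof -
    have "1 \<in> S n" by (auto simp: S_def)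
    hence "S n = {1} \<union> (S n - {1})" by auto
    also have "infsum a \<dots> = 1 + infsum a (S n - {1})"
      by (subst infsum_Un_disjoint) (auto intro: summ simp: \<open>a 1 = 1\<close>[simplified])
    finally have "norm (infsum a (S n) - 1) = norm (infsum a (S n - {1}))" by simp
    also have "\<dots> \<le> infsum (\<lambda>k. norm (a k)) (S n - {1})"
      by (rule norm_infsum_bound[OF norm_summ])
    also have "\<dots> \<le> infsum (\<lambda>k. norm (a k)) {n<..}"
    proof (rule infsum_mono2[OF norm_summ norm_summ])
      show "S n - {1} \<subseteq> {n<..}"
      proof
        fix k assume k: "k \<in> S n - {1}"
        then obtain p where "prime p" "p dvd k" using prime_factor_nat by blast
        with k show "k \<in> {n<..}"
          by (auto simp: S_def dest: dvd_imp_le intro: less_le_trans not_le_imp_less)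
      qed
    qed auto
    also have "infsum (\<lambda>k. norm (a k)) {n<..}
        = infsum (\<lambda>k. norm (a k)) UNIV - (\<Sum>k\<le>n. norm (a k))"
    proof -
      have "infsum (\<lambda>k. norm (a k)) ({..n} \<union> {n<..})
          = (\<Sum>k\<le>n. norm (a k)) + infsum (\<lambda>k. norm (a k)) {n<..}"
        by (subst infsum_Un_disjoint) (auto intro: norm_summ)
      moreover have "{..n} \<union> {n<..} = UNIV" by auto
      ultimately show ?thesis by simp
    qed
    finally show ?thesis .
  qed
  have "(\<lambda>k. norm (a k)) sums infsum (\<lambda>k. norm (a k)) UNIV"
    by (rule has_sum_imp_sums[OF has_sum_infsum[OF norm_summ]])
  hence "(\<lambda>n. \<Sum>k\<le>n. norm (a k)) \<longlonglongrightarrow> infsum (\<lambda>k. norm (a k)) UNIV"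
    by (simp add: sums_def_le)
  from tendsto_diff[OF tendsto_const[of "infsum (\<lambda>k. norm (a k)) UNIV"] this]
  have "(\<lambda>n. infsum (\<lambda>k. norm (a k)) UNIV - (\<Sum>k\<le>n. norm (a k))) \<longlonglongrightarrow> 0" by simp
  hence "(\<lambda>n. infsum a (S n) - 1) \<longlonglongrightarrow> 0"
    by (rule Lim_null_comparison[OF always_eventually, rotated]) (use bound in blast)
  hence "(\<lambda>n. infsum a (S n)) \<longlonglongrightarrow> 1" by (simp add: LIM_zero_iff)
  thus ?thesis by (simp only: S)
qed

lemma zeta_euler_product:
  assumes "Re s > 1"
  shows "riemann_zeta s \<noteq> 0"
    and "(\<lambda>n. \<Prod>p | prime p \<and> p \<le> n. 1 - of_nat p powr (-s)) \<longlonglongrightarrow> 1 / riemann_zeta s"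
proof -
  define a where "a k = complex_of_nat k powr (-s)" for k
  have norm_a: "norm (a k) = real k powr (- Re s)" for k
    by (cases "k = 0") (simp_all add: a_def norm_powr_real_powr)
  have summ: "summable (\<lambda>k. norm (a k))"
    using assms by (simp add: norm_a summable_real_powr_iff)
  have "a summable_on UNIV" by (rule norm_summable_imp_summable_on[OF summ])
  hence "a summable_on {0<..}" by (rule summable_on_subset_banach) simp
  moreover have "bij_betw Suc UNIV {0<..}"
    by (auto simp: bij_betw_def greaterThan_0)
  ultimately have "((\<lambda>k. a (Suc k)) has_sum infsum a {0<..}) UNIV"
    by (subst has_sum_reindex_bij_betw) auto
  hence zeta: "infsum a {0<..} = riemann_zeta s"
    unfolding riemann_zeta_def
    by (subst sums_unique[OF has_sum_imp_sums]) (auto simp: a_def powr_minus_divide)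
  have lim: "(\<lambda>n. (\<Prod>p | prime p \<and> p \<le> n. 1 - a p) * riemann_zeta s) \<longlonglongrightarrow> 1"
    unfolding zeta[symmetric]
    by (rule euler_product[OF _ _ summ]) (simp_all only: a_def powr_of_nat_mult, simp)
  show nz: "riemann_zeta s \<noteq> 0"
  proof
    assume "riemann_zeta s = 0"
    with lim show False by (simp add: LIMSEQ_const_iff)
  qed
  show "(\<lambda>n. \<Prod>p | prime p \<and> p \<le> n. 1 - of_nat p powr (-s)) \<longlonglongrightarrow> 1 / riemann_zeta s"
    using tendsto_divide[OF lim tendsto_const nz] nz by (simp add: a_def)
qed

lemma riemann_zeta_2: "riemann_zeta 2 = of_real (pi\<^sup>2 / 6)"
proof -
  have "(\<lambda>n. complex_of_real (1 / (real n + 1)\<^sup>2)) sums of_real (pi\<^sup>2 / 6)"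
    using inverse_squares_sums by (intro sums_of_real) (simp add: add.commute)
  moreover have "complex_of_real (1 / (real n + 1)\<^sup>2) = 1 / of_nat (Suc n) powr 2" for n
    by (simp add: powr_nat' add.commute)
  ultimately show ?thesis unfolding riemann_zeta_def by (simp add: sums_iff)
qed

section \<open>Passing to the limit\<close>

text \<open>
  The bound \<open>n \<ge> 3\<close> makes both \<open>2\<close> and \<open>3\<close> prime factors of \<open>m\<close>, so that \<open>m\<close> is not prime.
\<close>
lemma gcd_sum_tendsto:
  assumes "Re s > 1" and pos: "\<And>n. M n > 0"
    and factors: "\<And>n. prime_factors (M n) = {p. prime p \<and> p \<le> n}"
  shows "(\<lambda>n. gcd_sum s (M n)) \<longlonglongrightarrow> 1 / riemann_zeta s - 1"
proof (rule Lim_transform_eventually)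
  show "(\<lambda>n. (\<Prod>p | prime p \<and> p \<le> n. 1 - of_nat p powr (-s)) - 1)
      \<longlonglongrightarrow> 1 / riemann_zeta s - 1"
    by (intro tendsto_intros zeta_euler_product assms)
  show "\<forall>\<^sub>F n in sequentially.
      (\<Prod>p | prime p \<and> p \<le> n. 1 - of_nat p powr (-s)) - 1 = gcd_sum s (M n)"
    using eventually_ge_at_top[of 3]
  proof eventually_elim
    case (elim n)
    hence "2 \<in> prime_factors (M n)" "3 \<in> prime_factors (M n)" by (auto simp: factors)
    hence "\<not> prime (M n)"
      by (metis in_prime_factors_iff numeral_eq_iff primes_dvd_imp_eq semiring_norm(88))
    thus ?case by (simp add: gcd_sum_eq_euler_product[OF pos] factors)
  qed
qed

lemma gcd_sum_sq_eq: "gcd_sum_sq m = - Re (gcd_sum 2 m)"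
proof -
  have sign: "(-1) powi (int k - 1) = - ((-1) ^ k :: real)" for k
    by (simp add: power_int_diff)
  have "complex_of_real (gcd_sum_sq m) = - gcd_sum 2 m"
    by (simp add: gcd_sum_sq_def gcd_sum_def sign powr_nat' sum_negf)
  thus ?thesis by (metis Re_complex_of_real uminus_complex.sel(1))
qed

lemma gcd_sum_sq_tendsto:
  assumes "\<And>n. M n > 0" "\<And>n. prime_factors (M n) = {p. prime p \<and> p \<le> n}"
  shows "(\<lambda>n. gcd_sum_sq (M n)) \<longlonglongrightarrow> 1 - 6 / pi\<^sup>2"
proof -
  have "(\<lambda>n. gcd_sum 2 (M n)) \<longlonglongrightarrow> 1 / riemann_zeta 2 - 1"
    by (rule gcd_sum_tendsto) (use assms in auto)
  moreover have "1 / riemann_zeta 2 - 1 = complex_of_real (6 / pi\<^sup>2 - 1)"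
    by (simp add: riemann_zeta_2)
  ultimately have "(\<lambda>n. - Re (gcd_sum 2 (M n))) \<longlonglongrightarrow> - (6 / pi\<^sup>2 - 1)"
    by (metis Re_complex_of_real tendsto_Re tendsto_minus)
  thus ?thesis by (simp add: gcd_sum_sq_eq)
qed

lemma prime_factors_fact: "prime_factors (fact n :: nat) = {p. prime p \<and> p \<le> n}"
  by (auto simp: prime_factors_dvd prime_dvd_fact_iff)

lemma primorial_pos: "primorial n > 0"
  by (auto simp: primorial_def prime_gt_0_nat intro!: prod_pos)

lemma prime_factors_primorial: "prime_factors (primorial n) = {p. prime p \<and> p \<le> n}"
proof -
  have "finite {p::nat. prime p \<and> p \<le> n}" by simp
  hence "p dvd primorial n \<longleftrightarrow> p \<le> n" if "prime p" for p
    unfolding primorial_def using that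
    by (auto simp: prime_dvd_prod_iff dest: primes_dvd_imp_eq)
  thus ?thesis using primorial_pos[of n] by (auto simp: prime_factors_dvd)
qed

theorem mainTheorem10:
  shows "(\<forall>s::complex. Re s > 1 \<longrightarrow>
            riemann_zeta s \<noteq> 0 \<and>
            convergent (\<lambda>n. gcd_sum s (fact n)) \<and>
            1 / riemann_zeta s = 1 + lim (\<lambda>n. gcd_sum s (fact n)))
       \<and> (\<lambda>n. gcd_sum_sq (fact n)) \<longlonglongrightarrow> 1 - 6 / pi\<^sup>2
       \<and> (\<forall>s::complex. Re s > 1 \<longrightarrow>
            convergent (\<lambda>n. gcd_sum s (primorial n)) \<and>
            1 / riemann_zeta s = 1 + lim (\<lambda>n. gcd_sum s (primorial n)))
       \<and> (\<lambda>n. gcd_sum_sq (primorial n)) \<longlonglongrightarrow> 1 - 6 / pi\<^sup>2"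
proof -
  have main: "riemann_zeta s \<noteq> 0 \<and> convergent (\<lambda>n. gcd_sum s (M n)) \<and>
      1 / riemann_zeta s = 1 + lim (\<lambda>n. gcd_sum s (M n))"
    if "Re s > 1" "\<And>n. M n > 0" "\<And>n. prime_factors (M n) = {p. prime p \<and> p \<le> n}" for s M
    using zeta_euler_product(1)[OF that(1)] gcd_sum_tendsto[OF that]
    by (auto simp: convergent_def limI)
  show ?thesis
    using main[of _ fact] main[of _ primorial] gcd_sum_sq_tendsto[of fact]
      gcd_sum_sq_tendsto[of primorial] prime_factors_fact primorial_pos prime_factors_primorial
    by auto
qed

end
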